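(* Given $n$ and $\lambda_0$, there exist constants $T,\omega>1$ such that the following holds. Let $M_t\subset\mathbf R^{n+1}$ be a mean curvature flow with entropy at most $\lambda_0$. If $M_t$ is $(j,\eta)$-cylindrical at $(x_0,t_0)$ on the time-scale $\tau>0$ for some $\eta<1$, then for every $s\in(0,\tau)$ $$B_{\eta^{-1}\frac{\sqrt s}{2}}(x_0)\cap M_t=\emptyset\quad\text{for } t\in\left(t_0+(T-1)s,\ t_0+\left(\frac{\eta^{-2}-4\omega^2}{4\omega^2}\right)s\right).$$
   Context: Mean curvature flow (MCF): a one-parameter family of hypersurfaces $M_t\subset\mathbf R^{n+1}$ moving with normal velocity equal to the mean curvature vector, possibly continued past singularities as a weak solution (Brakke flow) for which Huisken's monotonicity formula holds: with $$F_{x,\tau}(\Sigma)=(4\pi\tau)^{-n/2}\int_\Sigma e^{-|y-x|^2/(4\tau)}\,dy ,$$ $F_{x,\tau_1}(M_{t-\tau_1})\le F_{x,\tau_2}(M_{t-\tau_2})$ for $0<\tau_1<\tau_2$; the limiting density $\lim_{\tau\to0_+}F_{x,\tau}(M_{t-\tau})$ is at least $1$ at each point in the support of the flow. The entropy is $\lambda(\Sigma)=\sup_{x\in\mathbf R^{n+1},\tau>0}F_{x,\tau}(\Sigma)$, and the flow has entropy at most $\lambda_0$ if $\lambda(M_t)\le\lambda_0$ for all $t$. For $0\le j<n$, $\mathcal C_j$ denotes the cylinder $\mathbf R^j\times\mathbf S^{n-j}_{\sqrt{2(n-j)}}$ together with all its rotations and translations in $\mathbf R^{n+1}$. For $z\in\mathbf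 R^{n+1}$, $r>0$, $\Psi_{z,r}(\Lambda)=\{r(x-z)+z: x\in\Lambda\}$. $M_t$ is $(j,\eta)$-cylindrical at $(y,t)$ on the time-scale $\tau$ if there is a fixed cylinder in $\mathcal C_j$ such that for every positive $s\le\tau$ the set $\Psi_{y,1/\sqrt s}\big(B_{\eta^{-1}\sqrt s}(y)\cap M_{t-s}\big)$ is a graph over this cylinder of a function with $C^1$ norm at most $\eta$. *)

theory Defs
  imports "HOL-Analysis.Analysis"
begin

text \<open>
  Throughout, the type \<open>'a\<close> is the ambient Euclidean space of dimension \<open>n + 1\<close>.
  An evolving (possibly singular) hypersurface is represented as in Brakke's theory by the
  family of its area measures \<open>\<mu> t\<close>, where \<open>t\<close> ranges over a time interval \<open>I\<close>;
  the set \<open>M\<^sub>t\<close> is the support of \<open>\<mu> t\<close>.  For a smooth properly embedded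
  flow, \<open>\<mu> t\<close> is \<open>n\<close>-dimensional area restricted to \<open>M\<^sub>t\<close>.
\<close>

definition support :: "'a::euclidean_space measure \<Rightarrow> 'a set" where
  "support \<mu> = {x. \<forall>r>0. emeasure \<mu> (ball x r) > 0}"

definition radon_measure :: "'a::euclidean_space measure \<Rightarrow> bool" where
  "radon_measure \<mu> \<longleftrightarrow> sets \<mu> = sets borel \<and> (\<forall>K. compact K \<longrightarrow> emeasure \<mu> K < \<infinity>)"


section \<open>Gaussian area and entropy\<close>

definition gauss_area :: "nat \<Rightarrow> 'a::euclidean_space \<Rightarrow> real \<Rightarrow> 'a measure \<Rightarrow> ennreal" where
  "gauss_area n x \<tau> \<mu> =
     ennreal ((4 * pi * \<tau>) powr (- real n / 2)) *
     (\<integral>\<^sup>+ y. ennreal (exp (- (norm (y - x))\<^sup>2 / (4 * \<tau>))) \<partial>\<mu>)"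

definition entropy :: "nat \<Rightarrow> 'a::euclidean_space measure \<Rightarrow> ennreal" where
  "entropy n \<mu> = (SUP x. SUP \<tau>\<in>{0<..}. gauss_area n x \<tau> \<mu>)"


section \<open>Brakke flows\<close>

definition C1_on :: "'a::euclidean_space set \<Rightarrow> ('a \<Rightarrow> 'b::real_normed_vector) \<Rightarrow> bool" where
  "C1_on W f \<longleftrightarrow> (\<forall>x\<in>W. f differentiable (at x)) \<and>
     (\<forall>v. continuous_on W (\<lambda>x. frechet_derivative f (at x) v))"

definition grad :: "('a::euclidean_space \<Rightarrow> real) \<Rightarrow> 'a \<Rightarrow> 'a" where
  "grad f x = (\<Sum>b\<in>Basis. frechet_derivative f (at x) b *\<^sub>R b)"

definition test_function :: "('a::euclidean_space \<Rightarrow> real) \<Rightarrow> bool" where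
  "test_function \<phi> \<longleftrightarrow> C1_on UNIV \<phi> \<and> C1_on UNIV (grad \<phi>) \<and> (\<forall>x. \<phi> x \<ge> 0) \<and>
     compact (closure {x. \<phi> x \<noteq> 0})"

text \<open>
  For an orthonormal set \<open>B\<close> this is the \<open>card B\<close>-dimensional area measure on the
  plane \<open>span B\<close>.
\<close>

definition plane_measure :: "'a::euclidean_space set \<Rightarrow> 'a measure" where
  "plane_measure B = distr (\<Pi>\<^sub>M b\<in>B. lborel) borel (\<lambda>c. \<Sum>b\<in>B. c b *\<^sub>R b)"

text \<open>
  The rescalings \<open>A \<mapsto> \<mu> (x + r A) / r\<^sup>n\<close> converge weakly, as \<open>r \<longlongrightarrow> 0\<close>, to \<open>\<theta>\<close>
  times the area measure of the hyperplane orthogonal to the unit vector \<open>\<nu>\<close>.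
\<close>

definition tangent_plane ::
    "nat \<Rightarrow> 'a::euclidean_space measure \<Rightarrow> 'a \<Rightarrow> 'a \<Rightarrow> real \<Rightarrow> bool" where
  "tangent_plane n \<mu> x \<nu> \<theta> \<longleftrightarrow> norm \<nu> = 1 \<and> \<theta> > 0 \<and>
     (\<exists>B. pairwise orthogonal B \<and> (\<forall>b\<in>B. norm b = 1) \<and> span B = {v. \<nu> \<bullet> v = 0} \<and>
        (\<forall>f :: 'a \<Rightarrow> real. continuous_on UNIV f \<and> compact (closure {y. f y \<noteq> 0}) \<longrightarrow>
           ((\<lambda>r. (LINT y|\<mu>. f ((y - x) /\<^sub>R r)) / r ^ n)
              \<longlongrightarrow> \<theta> * (LINT y|plane_measure B. f y)) (at_right 0)))"

definition integral_measure :: "nat \<Rightarrow> 'a::euclidean_space measure \<Rightarrow> bool" where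
  "integral_measure n \<mu> \<longleftrightarrow> radon_measure \<mu> \<and>
     (AE x in \<mu>. \<exists>\<nu>. \<exists>k::nat. tangent_plane n \<mu> x \<nu> (real k))"

definition tangential_div ::
    "('a::euclidean_space \<Rightarrow> 'a) \<Rightarrow> 'a \<Rightarrow> 'a \<Rightarrow> real" where
  "tangential_div X \<nu> x =
     (\<Sum>b\<in>Basis. b \<bullet> frechet_derivative X (at x) b) - \<nu> \<bullet> frechet_derivative X (at x) \<nu>"

text \<open>
  In the open set \<open>U\<close> the measure \<open>\<mu>\<close> is rectifiable with unit normal \<open>\<nu>\<close>, and its first
  variation is absolutely continuous with respect to \<open>\<mu>\<close>, with generalized mean curvature
  vector \<open>H\<close>.
\<close>

definition mean_curvature_in ::
    "nat \<Rightarrow> 'a::euclidean_space measure \<Rightarrow> 'a set \<Rightarrow> ('a \<Rightarrow> 'a) \<Rightarrow> ('a \<Rightarrow> 'a) \<Rightarrow> bool" where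
  "mean_curvature_in n \<mu> U \<nu> H \<longleftrightarrow>
     \<nu> \<in> borel_measurable borel \<and> H \<in> borel_measurable borel \<and>
     (AE x in \<mu>. x \<in> U \<longrightarrow> (\<exists>\<theta>. tangent_plane n \<mu> x (\<nu> x) \<theta>)) \<and>
     (\<forall>K. compact K \<and> K \<subseteq> U \<longrightarrow> set_integrable \<mu> K H) \<and>
     (\<forall>X :: 'a \<Rightarrow> 'a. C1_on UNIV X \<and> compact (closure {x. X x \<noteq> 0}) \<and>
        closure {x. X x \<noteq> 0} \<subseteq> U \<longrightarrow>
        (LINT x|\<mu>. tangential_div X (\<nu> x) x) = - (LINT x|\<mu>. H x \<bullet> X x))"

text \<open>
  Brakke's functional \<open>B(\<mu>, \<phi>) = \<integral> - \<phi> |H|\<^sup>2 + (\<nabla>\<phi>)\<^sup>\<bottom> \<bullet> H d\<mu>\<close>, in Ilmanen's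
  convention: its value is \<open>-\<infinity>\<close> when \<open>H\<close> does not exist on \<open>{\<phi> > 0}\<close> or \<open>\<phi> |H|\<^sup>2\<close> is not
  integrable.  Since \<open>H\<close> is unique and \<open>\<nu>\<close> is unique up to sign almost everywhere
  on \<open>{\<phi> > 0}\<close>, the set below has at most one element, and its supremum is \<open>-\<infinity>\<close> when it is
  empty.
\<close>

definition brakke_functional ::
    "nat \<Rightarrow> 'a::euclidean_space measure \<Rightarrow> ('a \<Rightarrow> real) \<Rightarrow> ereal" where
  "brakke_functional n \<mu> \<phi> = Sup
     {ereal (LINT x|\<mu>. - \<phi> x * (norm (H x))\<^sup>2 + ((grad \<phi> x \<bullet> \<nu> x) *\<^sub>R \<nu> x) \<bullet> H x) | \<nu> H.
        mean_curvature_in n \<mu> {x. \<phi> x > 0} \<nu> H \<and>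
        integrable \<mu> (\<lambda>x. \<phi> x * (norm (H x))\<^sup>2)}"

text \<open>
  The left-hand side of the inequality is the upper derivative of
  \<open>s \<mapsto> \<integral> \<phi> d(\<mu> s)\<close> at time \<open>t\<close>.
\<close>

definition brakke_flow ::
    "nat \<Rightarrow> real set \<Rightarrow> (real \<Rightarrow> 'a::euclidean_space measure) \<Rightarrow> bool" where
  "brakke_flow n I \<mu> \<longleftrightarrow> is_interval I \<and>
     (\<forall>t\<in>I. radon_measure (\<mu> t)) \<and>
     (AE t in lborel. t \<in> I \<longrightarrow> integral_measure n (\<mu> t)) \<and>
     (\<forall>t\<in>I. \<forall>\<phi>. test_function \<phi> \<longrightarrow>
        Limsup (at t within I)
          (\<lambda>s. ereal (((LINT x|\<mu> s. \<phi> x) - (LINT x|\<mu> t. \<phi> x)) / (s - t)))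
        \<le> brakke_functional n (\<mu> t) \<phi>)"


section \<open>Mean curvature flow\<close>

definition flow_support :: "real set \<Rightarrow> (real \<Rightarrow> 'a::euclidean_space measure) \<Rightarrow> ('a \<times> real) set"
  where
  "flow_support I \<mu> = (UNIV \<times> I) \<inter> closure {(x, t). t \<in> I \<and> x \<in> support (\<mu> t)}"

definition huisken_monotone ::
    "nat \<Rightarrow> real set \<Rightarrow> (real \<Rightarrow> 'a::euclidean_space measure) \<Rightarrow> bool" where
  "huisken_monotone n I \<mu> \<longleftrightarrow>
     (\<forall>x t \<tau>\<^sub>1 \<tau>\<^sub>2. 0 < \<tau>\<^sub>1 \<and> \<tau>\<^sub>1 < \<tau>\<^sub>2 \<and> t - \<tau>\<^sub>1 \<in> I \<and> t - \<tau>\<^sub>2 \<in> I \<longrightarrow>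
        gauss_area n x \<tau>\<^sub>1 (\<mu> (t - \<tau>\<^sub>1)) \<le> gauss_area n x \<tau>\<^sub>2 (\<mu> (t - \<tau>\<^sub>2)))"

text \<open>
  The density at \<open>(x, t)\<close> involves only earlier times, so the initial time of the flow (if
  any) is exempt.
\<close>

definition density_ge_one ::
    "nat \<Rightarrow> real set \<Rightarrow> (real \<Rightarrow> 'a::euclidean_space measure) \<Rightarrow> bool" where
  "density_ge_one n I \<mu> \<longleftrightarrow>
     (\<forall>(x, t) \<in> flow_support I \<mu>. (\<exists>t'\<in>I. t' < t) \<longrightarrow>
        (\<exists>d\<ge>1. ((\<lambda>\<tau>. gauss_area n x \<tau> (\<mu> (t - \<tau>))) \<longlongrightarrow> d) (at_right 0)))"

definition mean_curvature_flow ::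
    "nat \<Rightarrow> real set \<Rightarrow> (real \<Rightarrow> 'a::euclidean_space measure) \<Rightarrow> bool" where
  "mean_curvature_flow n I \<mu> \<longleftrightarrow>
     brakke_flow n I \<mu> \<and> huisken_monotone n I \<mu> \<and> density_ge_one n I \<mu>"

definition flow_entropy_le ::
    "nat \<Rightarrow> real set \<Rightarrow> (real \<Rightarrow> 'a::euclidean_space measure) \<Rightarrow> real \<Rightarrow> bool" where
  "flow_entropy_le n I \<mu> \<Lambda>\<^sub>0 \<longleftrightarrow> (\<forall>t\<in>I. entropy n (\<mu> t) \<le> ennreal \<Lambda>\<^sub>0)"


section \<open>Cylinders and cylindrical points\<close>

text \<open>
  The standard cylinder has as its \<open>\<real>\<^sup>j\<close> factor the coordinate plane spanned by a set \<open>J\<close> of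
  \<open>j\<close> basis vectors; \<open>off_axis J\<close> is the projection to the orthogonal complement, of dimension
  \<open>n + 1 - j\<close>, which contains the sphere factor.  The members of the class \<open>\<C>\<^sub>j\<close> are the images under
  \<open>x \<mapsto> c + f x\<close> with \<open>f\<close> orthogonal; allowing orthogonal maps with determinant \<open>-1\<close> adds
  nothing, since a coordinate reflection preserves the standard cylinder.
\<close>

definition off_axis :: "'a::euclidean_space set \<Rightarrow> 'a \<Rightarrow> 'a" where
  "off_axis J x = (\<Sum>b\<in>Basis - J. (x \<bullet> b) *\<^sub>R b)"

definition cylinder ::
    "nat \<Rightarrow> 'a::euclidean_space set \<Rightarrow> ('a \<Rightarrow> 'a) \<Rightarrow> 'a \<Rightarrow> 'a set" where
  "cylinder n J f c =
     (\<lambda>x. c + f x) ` {x. norm (off_axis J x) = sqrt (2 * (real n - real (card J)))}"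

definition cylinder_normal ::
    "'a::euclidean_space set \<Rightarrow> ('a \<Rightarrow> 'a) \<Rightarrow> 'a \<Rightarrow> 'a \<Rightarrow> 'a" where
  "cylinder_normal J f c p = f (sgn (off_axis J (inv f (p - c))))"

text \<open>
  \<open>S\<close> is a normal graph, over a relatively open subset \<open>C \<inter> W\<close> of the hypersurface \<open>C\<close> with unit
  normal \<open>N\<close>, of a function with \<open>C\<^sup>1\<close> norm (supremum of the function plus supremum of its
  intrinsic gradient) at most \<open>\<eta>\<close>.  A \<open>C\<^sup>1\<close> function on \<open>C \<inter> W\<close> is given as the restriction of an
  ambient one, and its intrinsic gradient is the tangential part of the ambient gradient.
\<close>

definition graph_over ::
    "'a::euclidean_space set \<Rightarrow> ('a \<Rightarrow> 'a) \<Rightarrow> real \<Rightarrow> 'a set \<Rightarrow> bool" where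
  "graph_over C N \<eta> S \<longleftrightarrow>
     (\<exists>W u a b. open W \<and> C1_on W u \<and> a \<ge> 0 \<and> b \<ge> 0 \<and> a + b \<le> \<eta> \<and>
        (\<forall>p\<in>C \<inter> W. \<bar>u p\<bar> \<le> a \<and> norm (grad u p - (grad u p \<bullet> N p) *\<^sub>R N p) \<le> b) \<and>
        S = (\<lambda>p. p + u p *\<^sub>R N p) ` (C \<inter> W))"

definition dilation :: "'a::euclidean_space \<Rightarrow> real \<Rightarrow> 'a set \<Rightarrow> 'a set" where
  "dilation z r \<Lambda> = (\<lambda>x. r *\<^sub>R (x - z) + z) ` \<Lambda>"

definition cylindrical_at ::
    "nat \<Rightarrow> real set \<Rightarrow> (real \<Rightarrow> 'a::euclidean_space measure) \<Rightarrow>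
     nat \<Rightarrow> real \<Rightarrow> 'a \<Rightarrow> real \<Rightarrow> real \<Rightarrow> bool" where
  "cylindrical_at n I \<mu> j \<eta> y t \<tau> \<longleftrightarrow>
     (\<exists>J f c. J \<subseteq> Basis \<and> card J = j \<and> orthogonal_transformation f \<and>
        (\<forall>s. 0 < s \<and> s \<le> \<tau> \<longrightarrow> t - s \<in> I \<and>
           graph_over (cylinder n J f c) (cylinder_normal J f c) \<eta>
             (dilation y (1 / sqrt s) (ball y (sqrt s / \<eta>) \<inter> support (\<mu> (t - s))))))"

end

theory Submission
  imports Defs "HOL-Probability.Distributions"
begin

text \<open>
  If \<open>x \<in> M\<^sub>t\<close> lay in the ball, the monotonicity formula would give
  \<open>F\<^bsub>x,\<theta>\<^esub>(M\<^bsub>t\<^sub>0 - s\<^esub>) \<ge> 1\<close> with \<open>\<theta> = t - t\<^sub>0 + s\<close>. But this Gaussian area is small. The time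
  bounds mean \<open>T s < \<theta>\<close> and \<open>\<omega> sqrt \<theta> < sqrt s / (2 \<eta>)\<close>, so the part outside
  the cylindrical ball is an exponentially small tail, controlled by the entropy. Inside the ball
  the support lies in a tube of width of order \<open>sqrt s\<close> around a plane of dimension \<open>j < n\<close>.
  On this tube the Gaussian of scale \<open>\<theta>\<close> is dominated by an average of Gaussians of scale
  \<open>s\<close>, and the entropy bound makes its contribution at most a constant times
  \<open>(s / \<theta>) powr ((n - j) / 2)\<close>. Only the inclusion of the support in the tube is used, so the
  multiplicity of \<open>\<mu>\<close> on the graph does not matter.
\<close>

section \<open>Gaussian averages\<close>

text \<open>The heat kernel on the line at time \<open>v\<close>, that is, the centred normal
  density of variance \<open>2 * v\<close>. In this parametrization times add under convolution, and
  products over coordinates yield the exponential weight of \<open>gauss_area\<close>.\<close>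

definition heat_kernel :: "real \<Rightarrow> real \<Rightarrow> real" where
  "heat_kernel v t = exp (- t\<^sup>2 / (4 * v)) / sqrt (4 * pi * v)"

lemma heat_kernel_nonneg [simp]: "0 \<le> v \<Longrightarrow> 0 \<le> heat_kernel v t"
  by (simp add: heat_kernel_def)

lemma heat_kernel_eq_normal_density:
  "0 \<le> v \<Longrightarrow> heat_kernel v = normal_density 0 (sqrt (2 * v))"
  by (rule ext) (simp add: heat_kernel_def normal_density_def mult_ac)

lemma borel_measurable_heat_kernel [measurable]:
  "heat_kernel v \<in> borel_measurable borel"
  unfolding heat_kernel_def by measurable

lemma nn_integral_heat_kernel:
  assumes "0 < v"
  shows "(\<integral>\<^sup>+ t. ennreal (heat_kernel v t) \<partial>lborel) = 1"
  using assms
  by (simp add: heat_kernel_eq_normal_density nn_integral_eq_integral)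

text \<open>Semigroup property: variances add when centred normal densities are convolved.\<close>

lemma heat_kernel_convolution:
  assumes "0 < v" "0 < w"
  shows "(\<integral>\<^sup>+ z. ennreal (heat_kernel v z) * ennreal (heat_kernel w (y - z)) \<partial>lborel)
    = ennreal (heat_kernel (v + w) y)"
proof -
  have "(\<integral>\<^sup>+ z. ennreal (normal_density 0 (sqrt (2 * w)) (y - z) *
      normal_density 0 (sqrt (2 * v)) z) \<partial>lborel)
    = ennreal (normal_density 0 (sqrt ((sqrt (2 * w))\<^sup>2 + (sqrt (2 * v))\<^sup>2)) y)"
    using fun_cong[OF conv_normal_density_zero_mean[of "sqrt (2 * w)" "sqrt (2 * v)"], of y] assms
    by simp
  then show ?thesis
    using assms
    by (simp add: heat_kernel_eq_normal_density ennreal_mult mult.commute add.commute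
        distrib_left)
qed

lemma norm_power2_Basis: "(norm (x :: 'a::euclidean_space))\<^sup>2 = (\<Sum>b\<in>Basis. (x \<bullet> b)\<^sup>2)"
  unfolding power2_norm_eq_inner by (subst euclidean_inner) (simp add: power2_eq_square)

lemma prod_heat_kernel:
  assumes "finite B"
  shows "(\<Prod>b\<in>B. heat_kernel v (c b))
    = exp (- (\<Sum>b\<in>B. (c b)\<^sup>2) / (4 * v)) / sqrt (4 * pi * v) ^ card B"
  using assms
  by (simp add: heat_kernel_def prod_dividef exp_sum[symmetric] sum_negf sum_divide_distrib)

lemma powr_neg_half:
  assumes "0 < v"
  shows "v powr (- real n / 2) = 1 / sqrt v ^ n"
proof -
  have "v powr (- real n / 2) = 1 / (v powr (1 / 2)) powr real n"
    by (simp add: powr_powr powr_minus_divide)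
  also have "\<dots> = 1 / sqrt v ^ n"
    using assms by (simp add: powr_half_sqrt powr_realpow)
  finally show ?thesis .
qed

section \<open>Gaussian area, Radon measures and their supports\<close>

lemma gauss_area_eq:
  assumes "0 < \<tau>"
  shows "gauss_area n x \<tau> \<mu> = ennreal (1 / sqrt (4 * pi * \<tau>) ^ n) *
     (\<integral>\<^sup>+ y. ennreal (exp (- (norm (y - x))\<^sup>2 / (4 * \<tau>))) \<partial>\<mu>)"
  using assms unfolding gauss_area_def by (subst powr_neg_half) simp_all

lemma gauss_area_le_entropy:
  assumes "0 < \<tau>"
  shows "gauss_area n x \<tau> \<mu> \<le> entropy n \<mu>"
  using assms unfolding entropy_def by (meson SUP_upper2 UNIV_I greaterThan_iff order_refl)

text \<open>Compact balls of integer radius exhaust the space. Sigma-finiteness serves the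
  interchange of integrals below.\<close>

lemma radon_measure_sigma_finite:
  assumes "radon_measure \<mu>"
  shows "sigma_finite_measure \<mu>"
proof
  have sets: "sets \<mu> = sets borel" and fin: "\<And>K. compact K \<Longrightarrow> emeasure \<mu> K < \<infinity>"
    using assms by (auto simp: radon_measure_def)
  have "(\<Union>k::nat. cball (0::'a) (real k)) = UNIV"
    by (auto simp: real_arch_simple)
  moreover have "space \<mu> = UNIV"
    using sets_eq_imp_space_eq[OF sets] by simp
  ultimately show "\<exists>A. countable A \<and> A \<subseteq> sets \<mu> \<and> \<Union>A = space \<mu> \<and> (\<forall>a\<in>A. emeasure \<mu> a \<noteq> \<infinity>)"
    using sets fin[OF compact_cball]
    by (intro exI[of _ "range (\<lambda>k::nat. cball (0::'a) (real k))"]) (auto simp: less_top)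
qed

text \<open>The complement of the support is a union of null balls; the Lindelof property reduces it
  to a countable union, hence to a null set.\<close>

lemma AE_in_support:
  assumes "sets \<mu> = sets borel"
  shows "AE y in \<mu>. y \<in> support \<mu>"
proof -
  obtain F where F: "F \<subseteq> {ball x r | x r. emeasure \<mu> (ball x r) = 0}" "countable F"
      "\<Union>F = \<Union>{ball x r | x r. emeasure \<mu> (ball x r) = 0}"
    by (rule Lindelof[of "{ball x r | x r. emeasure \<mu> (ball x r) = 0}"]) auto
  have "A \<in> null_sets \<mu>" if "A \<in> F" for A
    using F(1) that assms by (auto simp: null_sets_def)
  then have "\<Union>F \<in> null_sets \<mu>"
    using F(2) null_sets_UN'[of F "\<lambda>A. A" \<mu>] by simp
  moreover have "{y \<in> space \<mu>. y \<notin> support \<mu>} \<subseteq> \<Union>F"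
    unfolding F(3) support_def by (auto simp: zero_less_iff_neq_zero) (metis centre_in_ball)
  ultimately show ?thesis by (rule AE_I')
qed

text \<open>By the convolution identity, the anisotropic Gaussian on the left is an average of
  isotropic Gaussians of scale \<open>s\<close>, and each of those has integral at most the entropy bound.\<close>

lemma nn_integral_prod_heat_kernel_le:
  fixes \<mu> :: "'a::euclidean_space measure" and g :: "'a \<Rightarrow> 'a"
  assumes dim: "DIM('a) = n + 1" and radon: "radon_measure \<mu>"
    and ent: "entropy n \<mu> \<le> ennreal L" and L: "0 \<le> L"
    and g: "orthogonal_transformation g"
    and s: "0 < s" and v: "\<And>b. b \<in> Basis \<Longrightarrow> 0 < v b"
  shows "(\<integral>\<^sup>+ y. ennreal (\<Prod>b\<in>Basis. heat_kernel (v b + s) ((g y - p) \<bullet> b)) \<partial>\<mu>)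
    \<le> ennreal (L / sqrt (4 * pi * s))"
proof -
  interpret sigma_finite_measure \<mu> by (rule radon_measure_sigma_finite[OF radon])
  interpret pair_sigma_finite lborel \<mu> ..
  have sets [measurable_cong]: "sets \<mu> = sets borel"
    using radon by (simp add: radon_measure_def)
  have g_lin: "linear g" and g_norm: "\<And>y. norm (g y) = norm y"
    using g by (auto simp: orthogonal_transformation)
  have g_meas [measurable]: "g \<in> borel_measurable borel"
    using g_lin by (intro borel_measurable_continuous_onI linear_continuous_on)
      (simp add: linear_conv_bounded_linear)
  have g_inv: "g (inv g y) = y" for y
    by (rule surj_f_inv_f[OF orthogonal_transformation_surj[OF g]])
  \<comment> \<open>\<open>?W\<close> is a product probability density in the shift
    \<open>w\<close>; \<open>?G w\<close> is the isotropic kernel of scale \<open>s\<close> centred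
    at \<open>p + w\<close> in the coordinates given by \<open>g\<close>. The
    \<open>?W\<close>-average of \<open>?G\<close> is the anisotropic kernel.\<close>
  let ?W = "\<lambda>w. \<Prod>b\<in>Basis. ennreal (heat_kernel (v b) (w \<bullet> b))"
  let ?G = "\<lambda>w y. \<Prod>b\<in>Basis. ennreal (heat_kernel s ((g y - p - w) \<bullet> b))"
  have meas: "case_prod (\<lambda>w y. ?W w * ?G w y) \<in> borel_measurable (lborel \<Otimes>\<^sub>M \<mu>)"
    by measurable
  have conv: "ennreal (\<Prod>b\<in>Basis. heat_kernel (v b + s) ((g y - p) \<bullet> b))
      = (\<integral>\<^sup>+ w. ?W w * ?G w y \<partial>lborel)" for y
  proof -
    have "(\<integral>\<^sup>+ w. ?W w * ?G w y \<partial>lborel)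
      = (\<integral>\<^sup>+ w. (\<Prod>b\<in>Basis. ennreal (heat_kernel (v b) (w \<bullet> b)) *
          ennreal (heat_kernel s ((g y - p) \<bullet> b - w \<bullet> b))) \<partial>lborel)"
      by (simp add: prod.distrib inner_diff_left)
    also have "\<dots> = (\<Prod>b\<in>Basis. \<integral>\<^sup>+ z. ennreal (heat_kernel (v b) z) *
          ennreal (heat_kernel s ((g y - p) \<bullet> b - z)) \<partial>lborel)"
      by (subst nn_integral_lborel_prod[where f = "\<lambda>b z. ennreal (heat_kernel (v b) z) *
          ennreal (heat_kernel s ((g y - p) \<bullet> b - z))"]) auto
    also have "\<dots> = (\<Prod>b\<in>Basis. ennreal (heat_kernel (v b + s) ((g y - p) \<bullet> b)))"
      using s v by (intro prod.cong refl heat_kernel_convolution) auto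
    also have "\<dots> = ennreal (\<Prod>b\<in>Basis. heat_kernel (v b + s) ((g y - p) \<bullet> b))"
      using s v by (intro prod_ennreal heat_kernel_nonneg) (simp add: add_nonneg_nonneg less_imp_le)
    finally show ?thesis by simp
  qed
  \<comment> \<open>The isometry \<open>g\<close> pulls the centre back. The kernel is normalized in
    dimension \<open>n + 1\<close> and \<open>gauss_area\<close> in dimension \<open>n\<close>,
    whence the extra factor \<open>1 / sqrt (4 * pi * s)\<close>.\<close>
  have inner: "(\<integral>\<^sup>+ y. ?G w y \<partial>\<mu>) \<le> ennreal (L / sqrt (4 * pi * s))" for w
  proof -
    have "?G w y = ennreal (1 / sqrt (4 * pi * s)) * (ennreal (1 / sqrt (4 * pi * s) ^ n) *
        ennreal (exp (- (norm (y - inv g (p + w)))\<^sup>2 / (4 * s))))" for y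
    proof -
      have "norm (g y - p - w) = norm (y - inv g (p + w))"
        using g_norm[of "y - inv g (p + w)"] by (simp add: linear_diff[OF g_lin] g_inv algebra_simps)
      then have "(\<Prod>b\<in>Basis. heat_kernel s ((g y - p - w) \<bullet> b))
        = 1 / sqrt (4 * pi * s) * (1 / sqrt (4 * pi * s) ^ n *
          exp (- (norm (y - inv g (p + w)))\<^sup>2 / (4 * s)))"
        by (simp add: prod_heat_kernel dim norm_power2_Basis[symmetric])
      moreover have "?G w y = ennreal (\<Prod>b\<in>Basis. heat_kernel s ((g y - p - w) \<bullet> b))"
        using s by (intro prod_ennreal heat_kernel_nonneg) simp
      ultimately show ?thesis
        using s by (simp only: ennreal_mult'[symmetric]) (simp add: ennreal_mult'[symmetric])
    qed
    then have "(\<integral>\<^sup>+ y. ?G w y \<partial>\<mu>)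
      = ennreal (1 / sqrt (4 * pi * s)) * gauss_area n (inv g (p + w)) s \<mu>"
      using s by (simp add: gauss_area_eq nn_integral_cmult)
    also have "\<dots> \<le> ennreal (1 / sqrt (4 * pi * s)) * ennreal L"
      using gauss_area_le_entropy[OF s] ent by (intro mult_left_mono) (auto intro: order_trans)
    also have "\<dots> = ennreal (L / sqrt (4 * pi * s))"
      using L s by (simp add: ennreal_mult[symmetric])
    finally show ?thesis .
  qed
  have "(\<integral>\<^sup>+ y. ennreal (\<Prod>b\<in>Basis. heat_kernel (v b + s) ((g y - p) \<bullet> b)) \<partial>\<mu>)
    = (\<integral>\<^sup>+ w. (\<integral>\<^sup>+ y. ?W w * ?G w y \<partial>\<mu>) \<partial>lborel)"
    unfolding conv by (rule Fubini'[OF meas])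
  also have "\<dots> = (\<integral>\<^sup>+ w. ?W w * (\<integral>\<^sup>+ y. ?G w y \<partial>\<mu>) \<partial>lborel)"
    by (intro nn_integral_cong nn_integral_cmult) measurable
  also have "\<dots> \<le> (\<integral>\<^sup>+ w. ?W w * ennreal (L / sqrt (4 * pi * s)) \<partial>lborel)"
    by (intro nn_integral_mono mult_left_mono inner) auto
  also have "\<dots> = (\<integral>\<^sup>+ w. ?W w \<partial>lborel) * ennreal (L / sqrt (4 * pi * s))"
    by (intro nn_integral_multc) measurable
  \<comment> \<open>\<open>?W\<close> has total mass 1, so averaging keeps the bound.\<close>
  also have "(\<integral>\<^sup>+ w. ?W w \<partial>lborel) = 1"
    using v by (subst nn_integral_lborel_prod[where f = "\<lambda>b z. ennreal (heat_kernel (v b) z)"])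
      (auto simp: nn_integral_heat_kernel)
  finally show ?thesis by simp
qed

section \<open>The tube around a cylinder\<close>

lemma inner_off_axis_Basis:
  "b \<in> Basis \<Longrightarrow> off_axis J x \<bullet> b = (if b \<in> J then 0 else x \<bullet> b)"
  by (simp add: off_axis_def inner_sum_left inner_Basis if_distrib cong: if_cong)

lemma norm_off_axis_power2:
  assumes "J \<subseteq> Basis"
  shows "(norm (off_axis J x))\<^sup>2 = (\<Sum>b\<in>Basis - J. (x \<bullet> b)\<^sup>2)"
proof -
  have "(norm (off_axis J x))\<^sup>2 = (\<Sum>b\<in>Basis. if b \<in> J then 0 else (x \<bullet> b)\<^sup>2)"
    unfolding norm_power2_Basis by (intro sum.cong) (auto simp: inner_off_axis_Basis)
  also have "\<dots> = (\<Sum>b\<in>Basis - J. (x \<bullet> b)\<^sup>2)"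
    by (intro sum.mono_neutral_cong_right) auto
  finally show ?thesis .
qed

lemma off_axis_add: "off_axis J (x + y) = off_axis J x + off_axis J y"
  by (simp add: off_axis_def inner_add_left scaleR_add_left sum.distrib)

lemma off_axis_scaleR: "off_axis J (r *\<^sub>R x) = r *\<^sub>R off_axis J x"
  by (simp add: off_axis_def scaleR_sum_right)

lemma off_axis_idem: "off_axis J (off_axis J x) = off_axis J x"
  by (rule euclidean_eqI) (simp add: inner_off_axis_Basis)

text \<open>The normal of the cylinder is radial in the off-axis directions, so passing to the graph
  changes the off-axis radius by at most \<open>\<eta>\<close>, and the radius of the cylinder
  itself is at most \<open>sqrt (2 * real n)\<close>.\<close>

lemma graph_over_cylinder_in_tube:
  assumes f: "orthogonal_transformation f"
    and graph: "graph_over (cylinder n J f c) (cylinder_normal J f c) \<eta> S"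
    and \<eta>: "\<eta> \<le> 1" and q: "q \<in> S"
  shows "norm (off_axis J (inv f (q - c))) \<le> sqrt (2 * real n) + 1"
proof -
  have inj: "inv f (f x) = x" for x
    using orthogonal_transformation_inj[OF f] by simp
  have lin: "linear f" using f by (simp add: orthogonal_transformation_linear)
  obtain W u a b where W: "a \<ge> 0" "b \<ge> 0" "a + b \<le> \<eta>"
      "\<And>p. p \<in> cylinder n J f c \<inter> W \<Longrightarrow> \<bar>u p\<bar> \<le> a"
      "S = (\<lambda>p. p + u p *\<^sub>R cylinder_normal J f c p) ` (cylinder n J f c \<inter> W)"
    using graph unfolding graph_over_def by blast
  then obtain p where p: "p \<in> cylinder n J f c \<inter> W" "q = p + u p *\<^sub>R cylinder_normal J f c p"
    using q by blast
  then obtain x where x: "p = c + f x"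
      "norm (off_axis J x) = sqrt (2 * (real n - real (card J)))"
    by (auto simp: cylinder_def)
  have "q - c = f (x + u p *\<^sub>R sgn (off_axis J x))"
    unfolding p(2) by (simp add: x(1) cylinder_normal_def inj linear_add[OF lin] linear_cmul[OF lin])
  then have "off_axis J (inv f (q - c)) = off_axis J x + u p *\<^sub>R sgn (off_axis J x)"
    by (simp add: inj off_axis_add off_axis_scaleR off_axis_idem sgn_div_norm)
  also have "norm \<dots> \<le> norm (off_axis J x) + \<bar>u p\<bar> * norm (sgn (off_axis J x))"
    by (metis norm_scaleR norm_triangle_ineq)
  \<comment> \<open>Since \<open>b\<close> is nonnegative, \<open>a\<close> is at most 1;
    \<open>sgn\<close> has norm 0 or 1, which covers a vanishing off-axis part.\<close>
  also have "\<dots> \<le> sqrt (2 * real n) + 1 * 1"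
    using W(1-3) W(4)[OF p(1)] \<eta> x(2)
    by (intro add_mono mult_mono) (auto simp: norm_sgn)
  finally show ?thesis by simp
qed

text \<open>In the tube the isotropic Gaussian is compared with the one that is shrunk to scale \<open>2 s\<close> in
  the directions transverse to the axis; the centre moves to the axis in these directions.\<close>

lemma gaussian_le_anisotropic:
  fixes x y q :: "'a::euclidean_space"
  assumes dim: "DIM('a) = n + 1" and J: "J \<subseteq> Basis" "card J = j"
    and g: "orthogonal_transformation g" and s: "0 < s" "s < \<theta>"
    and tube: "norm (off_axis J (g y - q)) \<le> R * sqrt s"
  shows "exp (- (norm (y - x))\<^sup>2 / (4 * \<theta>))
    \<le> sqrt (4 * pi * \<theta>) ^ j * sqrt (8 * pi * s) ^ (n + 1 - j) * exp (R\<^sup>2 / 8) *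
      (\<Prod>b\<in>Basis. heat_kernel ((if b \<in> J then \<theta> - s else s) + s)
        ((g y - (g x - off_axis J (g x) + off_axis J q)) \<bullet> b))"
proof -
  \<comment> \<open>The centre \<open>?p\<close> has the axial coordinates of \<open>g x\<close> and
    the transverse ones of \<open>q\<close>; the kernel times become \<open>\<theta>\<close> along
    the axis and \<open>2 * s\<close> across it.\<close>
  let ?p = "g x - off_axis J (g x) + off_axis J q"
  have fin: "finite J" by (rule finite_subset[OF J(1) finite_Basis])
  have cardB: "card (Basis - J) = n + 1 - j"
    using J dim fin by (simp add: card_Diff_subset)
  have onJ: "(g y - ?p) \<bullet> b = (g y - g x) \<bullet> b" if "b \<in> J" for b
    using that J by (auto simp: inner_diff_left inner_add_left inner_off_axis_Basis)
  have offJ: "(g y - ?p) \<bullet> b = (g y - q) \<bullet> b" if "b \<in> Basis - J" for b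
    using that by (auto simp: inner_diff_left inner_add_left inner_off_axis_Basis)
  have "(\<Prod>b\<in>Basis. heat_kernel ((if b \<in> J then \<theta> - s else s) + s) ((g y - ?p) \<bullet> b))
    = (\<Prod>b\<in>J. heat_kernel \<theta> ((g y - g x) \<bullet> b)) *
      (\<Prod>b\<in>Basis - J. heat_kernel (2 * s) ((g y - q) \<bullet> b))"
    unfolding prod.subset_diff[OF J(1) finite_Basis]
    by (subst mult.commute) (intro arg_cong2[of _ _ _ _ "(*)"] prod.cong; simp add: onJ offJ)
  also have "\<dots> = (exp (- (\<Sum>b\<in>J. ((g y - g x) \<bullet> b)\<^sup>2) / (4 * \<theta>)) *
      exp (- (norm (off_axis J (g y - q)))\<^sup>2 / (8 * s))) /
      (sqrt (4 * pi * \<theta>) ^ j * sqrt (8 * pi * s) ^ (n + 1 - j))"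
    using fin by (simp add: prod_heat_kernel J cardB norm_off_axis_power2 mult.assoc)
  finally have eq: "sqrt (4 * pi * \<theta>) ^ j * sqrt (8 * pi * s) ^ (n + 1 - j) * exp (R\<^sup>2 / 8) *
      (\<Prod>b\<in>Basis. heat_kernel ((if b \<in> J then \<theta> - s else s) + s) ((g y - ?p) \<bullet> b))
    = exp (- (\<Sum>b\<in>J. ((g y - g x) \<bullet> b)\<^sup>2) / (4 * \<theta>)) *
      (exp (R\<^sup>2 / 8) * exp (- (norm (off_axis J (g y - q)))\<^sup>2 / (8 * s)))"
    using s by simp
  \<comment> \<open>Keeping only the axial part of the squared distance can only enlarge the
    Gaussian of scale \<open>\<theta>\<close>.\<close>
  have "(norm (y - x))\<^sup>2 = (norm (g y - g x))\<^sup>2"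
    using g orthogonal_transformation_norm[OF g, of "y - x"]
    by (simp add: linear_diff orthogonal_transformation_linear)
  also have "\<dots> \<ge> (\<Sum>b\<in>J. ((g y - g x) \<bullet> b)\<^sup>2)"
    unfolding norm_power2_Basis using J by (intro sum_mono2) auto
  finally have 1: "exp (- (norm (y - x))\<^sup>2 / (4 * \<theta>))
      \<le> exp (- (\<Sum>b\<in>J. ((g y - g x) \<bullet> b)\<^sup>2) / (4 * \<theta>))"
    using s by (simp add: divide_right_mono)
  \<comment> \<open>In the tube the transverse Gaussian of scale \<open>2 * s\<close> is at least
    \<open>exp (- (R\<^sup>2 / 8))\<close>, and the factor \<open>exp (R\<^sup>2 / 8)\<close>
    compensates for this.\<close>
  have "(norm (off_axis J (g y - q)))\<^sup>2 \<le> R\<^sup>2 * s"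
    using power_mono[OF tube norm_ge_zero, of 2] s by (simp add: power_mult_distrib)
  then have "(norm (off_axis J (g y - q)))\<^sup>2 / (8 * s) \<le> R\<^sup>2 / 8"
    using s by (simp add: field_simps)
  then have 2: "1 \<le> exp (R\<^sup>2 / 8) * exp (- (norm (off_axis J (g y - q)))\<^sup>2 / (8 * s))"
    by (simp add: exp_add[symmetric])
  show ?thesis
    unfolding eq using mult_mono[OF 1 2] by simp
qed

text \<open>On tube points the anisotropic average gains the power \<open>n - card J\<close> of
  \<open>sqrt (s / \<theta>)\<close>. At far points half of the exponent yields
  \<open>exp (- \<omega>\<^sup>2 / 8)\<close>, and the other half is a Gaussian of scale
  \<open>2 * \<theta>\<close>, controlled by the entropy.\<close>

lemma gauss_area_tube_le:
  fixes \<mu> :: "'a::euclidean_space measure" and g :: "'a \<Rightarrow> 'a"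
  assumes dim: "DIM('a) = n + 1" and radon: "radon_measure \<mu>"
    and ent: "entropy n \<mu> \<le> ennreal L" and L: "0 \<le> L"
    and J: "J \<subseteq> Basis" "card J < n" and g: "orthogonal_transformation g"
    and s: "0 < s" "s < \<theta>"
    and cover: "\<And>y. y \<in> support \<mu> \<Longrightarrow>
      norm (off_axis J (g y - q)) \<le> R * sqrt s \<or> \<omega>\<^sup>2 * \<theta> \<le> (norm (y - x))\<^sup>2"
  shows "gauss_area n x \<theta> \<mu>
    \<le> ennreal (L * exp (R\<^sup>2 / 8) * sqrt 2 ^ (n + 1) * sqrt (s / \<theta>)
      + L * sqrt 2 ^ n * exp (- \<omega>\<^sup>2 / 8))"
proof -
  define j where "j = card J"
  \<comment> \<open>\<open>A\<close> and \<open>D\<close> are the normalizing lengths at the scales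
    \<open>\<theta>\<close> and \<open>s\<close>; their ratio \<open>\<rho>\<close> carries the
    gain.\<close>
  define A D \<rho> where "A = sqrt (4 * pi * \<theta>)" and "D = sqrt (4 * pi * s)" and "\<rho> = sqrt (s / \<theta>)"
  have \<theta>: "0 < 2 * \<theta>" using s by simp
  have pos: "0 < A" "0 < D" "0 < \<rho>" "\<rho> \<le> 1" and D: "D = \<rho> * A"
    using s by (auto simp: A_def D_def \<rho>_def real_sqrt_mult[symmetric])
  have B: "sqrt (8 * pi * s) = sqrt 2 * D" and C: "sqrt (4 * pi * (2 * \<theta>)) = sqrt 2 * A"
    by (simp_all add: A_def D_def real_sqrt_mult[symmetric] mult_ac)
  define v where "v = (\<lambda>b. if b \<in> J then \<theta> - s else s)"
  define p where "p = g x - off_axis J (g x) + off_axis J q"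
  define K where "K = A ^ j * (sqrt 2 * D) ^ (n + 1 - j) * exp (R\<^sup>2 / 8)"
  define P where "P = (\<lambda>y. \<Prod>b\<in>Basis. heat_kernel (v b + s) ((g y - p) \<bullet> b))"
  define Q where "Q = (\<lambda>y. exp (- (norm (y - x))\<^sup>2 / (4 * (2 * \<theta>))))"
  have K: "0 \<le> K" using pos by (simp add: K_def)
  have P: "0 \<le> P y" for y
    using s unfolding P_def v_def by (intro prod_nonneg heat_kernel_nonneg) auto
  have sets [measurable_cong]: "sets \<mu> = sets borel"
    using radon by (simp add: radon_measure_def)
  have g_meas [measurable]: "g \<in> borel_measurable borel"
    using orthogonal_transformation_linear[OF g]
    by (intro borel_measurable_continuous_onI linear_continuous_on)
      (simp add: linear_conv_bounded_linear)
  have P_meas [measurable]: "P \<in> borel_measurable borel" and Q_meas [measurable]: "Q \<in> borel_measurable borel"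
    unfolding P_def Q_def by measurable

  \<comment> \<open>Both summands are nonnegative, so in each case a single one suffices.\<close>
  have pointwise: "exp (- (norm (y - x))\<^sup>2 / (4 * \<theta>)) \<le> K * P y + exp (- \<omega>\<^sup>2 / 8) * Q y"
    if "y \<in> support \<mu>" for y
    using cover[OF that]
  proof
    assume "norm (off_axis J (g y - q)) \<le> R * sqrt s"
    from gaussian_le_anisotropic[OF dim J(1) j_def[symmetric] g s this, of x]
    have "exp (- (norm (y - x))\<^sup>2 / (4 * \<theta>)) \<le> K * P y"
      by (simp add: K_def P_def v_def p_def A_def B)
    then show ?thesis by (simp add: Q_def add_increasing2)
  next
    assume "\<omega>\<^sup>2 * \<theta> \<le> (norm (y - x))\<^sup>2"
    then have "- (norm (y - x))\<^sup>2 / (4 * \<theta>) \<le> - \<omega>\<^sup>2 / 8 + - (norm (y - x))\<^sup>2 / (4 * (2 * \<theta>))"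
      using s by (simp add: field_simps)
    then have "exp (- (norm (y - x))\<^sup>2 / (4 * \<theta>)) \<le> exp (- \<omega>\<^sup>2 / 8) * Q y"
      unfolding Q_def exp_add[symmetric] by simp
    then show ?thesis using K P[of y] by (simp add: add_increasing)
  qed

  have int_P: "(\<integral>\<^sup>+ y. ennreal (P y) \<partial>\<mu>) \<le> ennreal (L / D)"
    unfolding P_def D_def
    by (rule nn_integral_prod_heat_kernel_le[OF dim radon ent L g s(1)]) (use s in \<open>auto simp: v_def\<close>)
  \<comment> \<open>Normalizing at scale \<open>2 * \<theta>\<close> instead of
    \<open>\<theta>\<close> costs the factor \<open>sqrt 2 ^ n\<close>.\<close>
  have int_Q: "(\<integral>\<^sup>+ y. ennreal (Q y) \<partial>\<mu>) \<le> ennreal ((sqrt 2 * A) ^ n * L)"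
  proof -
    have "(\<integral>\<^sup>+ y. ennreal (Q y) \<partial>\<mu>) = ennreal ((sqrt 2 * A) ^ n) * gauss_area n x (2 * \<theta>) \<mu>"
      using s pos unfolding gauss_area_eq[OF \<theta>] C
      by (simp add: Q_def mult.assoc[symmetric] ennreal_mult[symmetric])
    also have "\<dots> \<le> ennreal ((sqrt 2 * A) ^ n) * ennreal L"
      using gauss_area_le_entropy[OF \<theta>] ent
      by (intro mult_left_mono) (auto intro: order_trans)
    finally show ?thesis using L pos by (simp add: ennreal_mult)
  qed

  have "(\<integral>\<^sup>+ y. ennreal (exp (- (norm (y - x))\<^sup>2 / (4 * \<theta>))) \<partial>\<mu>)
    \<le> (\<integral>\<^sup>+ y. ennreal K * ennreal (P y) + ennreal (exp (- \<omega>\<^sup>2 / 8)) * ennreal (Q y) \<partial>\<mu>)"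
  proof (rule nn_integral_mono_AE, use AE_in_support[OF sets] in eventually_elim)
    fix y assume "y \<in> support \<mu>"
    from ennreal_leI[OF pointwise[OF this]]
    show "ennreal (exp (- (norm (y - x))\<^sup>2 / (4 * \<theta>)))
      \<le> ennreal K * ennreal (P y) + ennreal (exp (- \<omega>\<^sup>2 / 8)) * ennreal (Q y)"
      using K P[of y] by (simp add: ennreal_mult ennreal_plus Q_def)
  qed
  also have "\<dots> = ennreal K * (\<integral>\<^sup>+ y. ennreal (P y) \<partial>\<mu>)
      + ennreal (exp (- \<omega>\<^sup>2 / 8)) * (\<integral>\<^sup>+ y. ennreal (Q y) \<partial>\<mu>)"
    by (simp add: nn_integral_add nn_integral_cmult)
  also have "\<dots> \<le> ennreal K * ennreal (L / D)
      + ennreal (exp (- \<omega>\<^sup>2 / 8)) * ennreal ((sqrt 2 * A) ^ n * L)"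
    by (intro add_mono mult_left_mono int_P int_Q) auto
  also have "\<dots> = ennreal (K * (L / D) + exp (- \<omega>\<^sup>2 / 8) * ((sqrt 2 * A) ^ n * L))"
    using K L pos by (simp add: ennreal_mult ennreal_plus del: times_divide_eq_right)
  finally have "gauss_area n x \<theta> \<mu> \<le> ennreal (1 / A ^ n) *
      ennreal (K * (L / D) + exp (- \<omega>\<^sup>2 / 8) * ((sqrt 2 * A) ^ n * L))"
    using s unfolding A_def by (subst gauss_area_eq) (auto intro: mult_left_mono)
  also have "\<dots> = ennreal (1 / A ^ n * (K * (L / D) + exp (- \<omega>\<^sup>2 / 8) * ((sqrt 2 * A) ^ n * L)))"
    using K L pos by (intro ennreal_mult[symmetric]) auto
  also have "\<dots> \<le> ennreal (L * exp (R\<^sup>2 / 8) * sqrt 2 ^ (n + 1) * \<rho>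
      + L * sqrt 2 ^ n * exp (- \<omega>\<^sup>2 / 8))"
  proof (rule ennreal_leI)
    \<comment> \<open>There are \<open>m + 2\<close> transverse factors \<open>sqrt 2 * D\<close>.
      Dividing by \<open>D\<close> and by \<open>A ^ n\<close> leaves \<open>\<rho> ^ Suc m\<close>,
      so at least one factor \<open>\<rho>\<close> survives.\<close>
    obtain m where m: "n = j + Suc m"
      using J(2) less_imp_Suc_add[of j n] by (auto simp: j_def)
    have "1 / A ^ n * (K * (L / D)) = L * exp (R\<^sup>2 / 8) * (sqrt 2 ^ (m + 2) * (\<rho> * \<rho> ^ m))"
      using pos by (simp add: K_def m D power_mult_distrib power_add field_simps)
    also have "\<dots> \<le> L * exp (R\<^sup>2 / 8) * (sqrt 2 ^ (n + 1) * (\<rho> * 1))"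
      using pos L
      by (intro mult_left_mono mult_mono power_increasing power_le_one) (auto simp: m)
    finally have "1 / A ^ n * (K * (L / D)) \<le> L * exp (R\<^sup>2 / 8) * sqrt 2 ^ (n + 1) * \<rho>"
      by (simp add: mult.assoc)
    moreover have "1 / A ^ n * (exp (- \<omega>\<^sup>2 / 8) * ((sqrt 2 * A) ^ n * L))
        = L * sqrt 2 ^ n * exp (- \<omega>\<^sup>2 / 8)"
      using pos by (simp add: power_mult_distrib)
    ultimately show "1 / A ^ n * (K * (L / D) + exp (- \<omega>\<^sup>2 / 8) * ((sqrt 2 * A) ^ n * L))
        \<le> L * exp (R\<^sup>2 / 8) * sqrt 2 ^ (n + 1) * \<rho> + L * sqrt 2 ^ n * exp (- \<omega>\<^sup>2 / 8)"
      unfolding distrib_left by linarith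
  qed
  finally show ?thesis by (simp only: \<rho>_def)
qed

section \<open>Clearing out\<close>

text \<open>The density at a point of the support is at least 1, and it is the limit at scale 0 of a
  quantity that monotonicity makes nondecreasing in the scale. Intermediate times lie in
  \<open>I\<close> because \<open>I\<close> is an interval.\<close>

lemma one_le_gauss_area:
  assumes flow: "mean_curvature_flow n I \<mu>" and "t \<in> I" "x \<in> support (\<mu> t)"
    and "0 < \<theta>" "t - \<theta> \<in> I"
  shows "1 \<le> gauss_area n x \<theta> (\<mu> (t - \<theta>))"
proof -
  have "(x, t) \<in> flow_support I \<mu>"
    using assms(2,3) closure_subset unfolding flow_support_def by fastforce
  \<comment> \<open>The earlier time demanded by \<open>density_ge_one\<close> is
    \<open>t - \<theta>\<close>.\<close>
  then obtain d where d: "d \<ge> 1" "((\<lambda>\<tau>. gauss_area n x \<tau> (\<mu> (t - \<tau>))) \<longlongrightarrow> d) (at_right 0)"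
    using flow \<open>0 < \<theta>\<close> \<open>t - \<theta> \<in> I\<close>
    unfolding mean_curvature_flow_def density_ge_one_def by force
  have "eventually (\<lambda>\<tau>. \<tau> \<in> {0<..<\<theta>}) (at_right 0)"
    using \<open>0 < \<theta>\<close> by (rule eventually_at_right_real)
  then have "eventually (\<lambda>\<tau>. gauss_area n x \<tau> (\<mu> (t - \<tau>)) \<le> gauss_area n x \<theta> (\<mu> (t - \<theta>))) (at_right 0)"
  proof eventually_elim
    case (elim \<tau>)
    have "is_interval I"
      using flow by (simp add: mean_curvature_flow_def brakke_flow_def)
    then have "t - \<tau> \<in> I"
      by (rule mem_is_interval_1_I[OF _ \<open>t - \<theta> \<in> I\<close> \<open>t \<in> I\<close>]) (use elim in auto)
    moreover have "huisken_monotone n I \<mu>"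
      using flow by (simp add: mean_curvature_flow_def)
    ultimately show ?case
      using elim assms(5) unfolding huisken_monotone_def greaterThanLessThan_iff by blast
  qed
  then have "d \<le> gauss_area n x \<theta> (\<mu> (t - \<theta>))"
    by (rule tendsto_upperbound[OF d(2)]) simp
  with d(1) show ?thesis by (rule order_trans)
qed

text \<open>Being cylindrical gives the tube after dilation by \<open>1 / sqrt s\<close> about
  \<open>x\<^sub>0\<close>; undoing the dilation multiplies its radius by \<open>sqrt s\<close>. The
  map \<open>g\<close> is the inverse of the orthogonal map that places the cylinder.\<close>

lemma support_in_tube:
  fixes \<mu> :: "real \<Rightarrow> 'a::euclidean_space measure"
  assumes "cylindrical_at n I \<mu> j \<eta> x\<^sub>0 t\<^sub>0 \<tau>" "0 < s" "s \<le> \<tau>" "\<eta> \<le> 1"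
  obtains J q and g :: "'a \<Rightarrow> 'a" where
    "J \<subseteq> Basis" "card J = j" "orthogonal_transformation g" "t\<^sub>0 - s \<in> I"
    "\<And>y. y \<in> support (\<mu> (t\<^sub>0 - s)) \<Longrightarrow> y \<in> ball x\<^sub>0 (sqrt s / \<eta>) \<Longrightarrow>
      norm (off_axis J (g y - q)) \<le> (sqrt (2 * real n) + 1) * sqrt s"
proof -
  obtain J f c where J: "J \<subseteq> Basis" "card J = j" and f: "orthogonal_transformation f"
    and t: "t\<^sub>0 - s \<in> I" and graph: "graph_over (cylinder n J f c) (cylinder_normal J f c) \<eta>
      (dilation x\<^sub>0 (1 / sqrt s) (ball x\<^sub>0 (sqrt s / \<eta>) \<inter> support (\<mu> (t\<^sub>0 - s))))"
    using assms(1-3) unfolding cylindrical_at_def by blast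
  have g: "orthogonal_transformation (inv f)"
    using f by (rule orthogonal_transformation_inv)
  then have lin: "linear (inv f)" by (rule orthogonal_transformation_linear)
  show ?thesis
  proof (rule that[OF J g t])
    fix y assume y: "y \<in> support (\<mu> (t\<^sub>0 - s))" "y \<in> ball x\<^sub>0 (sqrt s / \<eta>)"
    \<comment> \<open>This local \<open>q\<close> is the dilated image of \<open>y\<close>. The
      point supplied for the conclusion is
      \<open>inv f (x\<^sub>0 + sqrt s *\<^sub>R (c - x\<^sub>0))\<close>, from \<open>c\<close>
      with the dilation undone.\<close>
    define q where "q = (1 / sqrt s) *\<^sub>R (y - x\<^sub>0) + x\<^sub>0"
    have "q \<in> dilation x\<^sub>0 (1 / sqrt s) (ball x\<^sub>0 (sqrt s / \<eta>) \<inter> support (\<mu> (t\<^sub>0 - s)))"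
      using y unfolding dilation_def q_def by blast
    then have "norm (off_axis J (inv f (q - c))) \<le> sqrt (2 * real n) + 1"
      by (rule graph_over_cylinder_in_tube[OF f graph \<open>\<eta> \<le> 1\<close>])
    moreover have "y - (x\<^sub>0 + sqrt s *\<^sub>R (c - x\<^sub>0)) = sqrt s *\<^sub>R (q - c)"
      using \<open>0 < s\<close> by (simp add: q_def algebra_simps)
    then have "inv f y - inv f (x\<^sub>0 + sqrt s *\<^sub>R (c - x\<^sub>0)) = sqrt s *\<^sub>R inv f (q - c)"
      by (simp only: linear_diff[OF lin, symmetric] linear_cmul[OF lin, symmetric])
    ultimately show "norm (off_axis J (inv f y - inv f (x\<^sub>0 + sqrt s *\<^sub>R (c - x\<^sub>0))))
        \<le> (sqrt (2 * real n) + 1) * sqrt s"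
      using \<open>0 < s\<close> by (simp add: off_axis_scaleR mult.commute mult_left_mono)
  qed
qed

text \<open>Makes the tube term and the tail term each smaller than 1/2, so that their sum cannot
  reach the density bound 1.\<close>

lemma clearing_constants:
  obtains T \<omega> :: real where "T > 1" "\<omega> > 1"
    "\<And>r. 0 \<le> r \<Longrightarrow> r \<le> 1 / T \<Longrightarrow> a * sqrt r < 1 / 2" "b * exp (- \<omega>\<^sup>2 / 8) < 1 / 2"
proof -
  \<comment> \<open>After squaring, \<open>a * sqrt r < 1 / 2\<close> follows from
    \<open>4 * a\<^sup>2 < T\<close>.\<close>
  define T where "T = 4 * a\<^sup>2 + 2"
  have T: "T > 1" by (simp add: T_def add_pos_nonneg)
  have 1: "a * sqrt r < 1 / 2" if "0 \<le> r" "r \<le> 1 / T" for r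
  proof (rule power2_less_imp_less)
    have "(a * sqrt r)\<^sup>2 \<le> a\<^sup>2 * (1 / T)"
      using that by (simp add: power_mult_distrib mult_left_mono del: times_divide_eq_right)
    also have "\<dots> < (1 / 2)\<^sup>2"
      using T by (simp add: T_def field_simps power2_eq_square)
    finally show "(a * sqrt r)\<^sup>2 < (1 / 2)\<^sup>2" .
  qed simp
  \<comment> \<open>By \<open>exp z \<ge> 1 + z\<close> it is enough that
    \<open>\<omega>\<^sup>2 / 8\<close> exceeds \<open>2 * \<bar>b\<bar> - 1\<close>; the cross term
    of the square alone contributes \<open>8 * \<bar>b\<bar>\<close>.\<close>
  define \<omega> where "\<omega> = 2 + 16 * \<bar>b\<bar>"
  have "2 * \<bar>b\<bar> < 1 + \<omega>\<^sup>2 / 8"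
  proof -
    have "\<omega>\<^sup>2 = 4 + 64 * \<bar>b\<bar> + 256 * b\<^sup>2"
      by (simp add: \<omega>_def power2_eq_square distrib_left distrib_right)
    then show ?thesis using zero_le_power2[of b] abs_ge_zero[of b] by linarith
  qed
  also have "\<dots> \<le> exp (\<omega>\<^sup>2 / 8)" by (rule exp_ge_add_one_self)
  finally have "b * exp (- \<omega>\<^sup>2 / 8) < 1 / 2"
    by (simp add: exp_minus field_simps)
  moreover have "\<omega> > 1" by (simp add: \<omega>_def)
  ultimately show ?thesis using that[OF T _ 1] by blast
qed

theorem theorem6p1:
  fixes n :: nat and \<Lambda>\<^sub>0 :: real
  assumes "DIM('a::euclidean_space) = n + 1"
  shows "\<exists>T \<omega> :: real. T > 1 \<and> \<omega> > 1 \<and>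
    (\<forall>(I :: real set) (\<mu> :: real \<Rightarrow> 'a measure) (j :: nat) (\<eta> :: real)
        (x\<^sub>0 :: 'a) (t\<^sub>0 :: real) (\<tau> :: real).
       mean_curvature_flow n I \<mu> \<longrightarrow>
       flow_entropy_le n I \<mu> \<Lambda>\<^sub>0 \<longrightarrow>
       j < n \<longrightarrow> 0 < \<eta> \<longrightarrow> \<eta> < 1 \<longrightarrow> 0 < \<tau> \<longrightarrow>
       cylindrical_at n I \<mu> j \<eta> x\<^sub>0 t\<^sub>0 \<tau> \<longrightarrow>
       (\<forall>s \<in> {0<..<\<tau>}.
          \<forall>t \<in> I \<inter> {t\<^sub>0 + (T - 1) * s <..< t\<^sub>0 + (1 / \<eta>\<^sup>2 - 4 * \<omega>\<^sup>2) / (4 * \<omega>\<^sup>2) * s}.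
            ball x\<^sub>0 (1 / \<eta> * (sqrt s / 2)) \<inter> support (\<mu> t) = {}))"
proof -
  \<comment> \<open>The \<open>max\<close> provides the nonnegative bound that the estimates
    require; \<open>R\<close> is the tube radius at unit scale. Both depend only on \<open>n\<close>
    and \<open>\<Lambda>\<^sub>0\<close>, hence so do \<open>T\<close> and
    \<open>\<omega>\<close>.\<close>
  define L R where "L = max \<Lambda>\<^sub>0 0" and "R = sqrt (2 * real n) + 1"
  obtain T \<omega> :: real where T: "T > 1" and \<omega>: "\<omega> > 1"
    and small: "\<And>r. 0 \<le> r \<Longrightarrow> r \<le> 1 / T \<Longrightarrow> L * exp (R\<^sup>2 / 8) * sqrt 2 ^ (n + 1) * sqrt r < 1 / 2"
      "L * sqrt 2 ^ n * exp (- \<omega>\<^sup>2 / 8) < 1 / 2"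
    by (rule clearing_constants[of "L * exp (R\<^sup>2 / 8) * sqrt 2 ^ (n + 1)" "L * sqrt 2 ^ n"]) blast
  have False
    if flow: "mean_curvature_flow n I \<mu>" and ent: "flow_entropy_le n I \<mu> \<Lambda>\<^sub>0"
      and j: "j < n" and \<eta>: "0 < \<eta>" "\<eta> < 1" and cyl: "cylindrical_at n I \<mu> j \<eta> x\<^sub>0 t\<^sub>0 \<tau>"
      and s: "0 < s" "s < \<tau>"
      and t: "t \<in> I" "t\<^sub>0 + (T - 1) * s < t" "t < t\<^sub>0 + (1 / \<eta>\<^sup>2 - 4 * \<omega>\<^sup>2) / (4 * \<omega>\<^sup>2) * s"
      and x: "x \<in> ball x\<^sub>0 (1 / \<eta> * (sqrt s / 2))" "x \<in> support (\<mu> t)"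
    for I and \<mu> :: "real \<Rightarrow> 'a measure" and j \<eta> x\<^sub>0 t\<^sub>0 \<tau> s t x
  proof -
    \<comment> \<open>The time elapsed from the cylindrical slice at \<open>t\<^sub>0 - s\<close> to
      \<open>t\<close> serves as the Gaussian scale.\<close>
    define \<theta> where "\<theta> = t - t\<^sub>0 + s"
    have \<theta>_gt: "T * s < \<theta>" using t(2) by (simp add: \<theta>_def algebra_simps)
    have "s < T * s" using T s by simp
    with \<theta>_gt have s_\<theta>: "s < \<theta>" by simp
    \<comment> \<open>Adding \<open>s\<close> cancels the \<open>- 4 * \<omega>\<^sup>2\<close> in
      the upper time bound.\<close>
    have "\<theta> < 1 / \<eta>\<^sup>2 / (4 * \<omega>\<^sup>2) * s"
      using t(3) \<omega> by (simp add: \<theta>_def diff_divide_distrib algebra_simps)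
    then have \<theta>_lt: "\<omega>\<^sup>2 * \<theta> < (sqrt s / (2 * \<eta>))\<^sup>2"
      using s \<omega> \<eta> by (simp add: power_divide power_mult_distrib field_simps)
    obtain J q and g :: "'a \<Rightarrow> 'a" where J: "J \<subseteq> Basis" "card J = j"
      and g: "orthogonal_transformation g" and I: "t\<^sub>0 - s \<in> I"
      and tube: "\<And>y. y \<in> support (\<mu> (t\<^sub>0 - s)) \<Longrightarrow> y \<in> ball x\<^sub>0 (sqrt s / \<eta>) \<Longrightarrow>
        norm (off_axis J (g y - q)) \<le> R * sqrt s"
      using support_in_tube[OF cyl s(1)] s \<eta> unfolding R_def by (metis less_imp_le)
    have t_\<theta>: "t - \<theta> = t\<^sub>0 - s" by (simp add: \<theta>_def)
    have "1 \<le> gauss_area n x \<theta> (\<mu> (t\<^sub>0 - s))"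
      using one_le_gauss_area[OF flow t(1) x(2), of \<theta>] I s s_\<theta> by (simp add: t_\<theta>)
    also have "\<dots> \<le> ennreal (L * exp (R\<^sup>2 / 8) * sqrt 2 ^ (n + 1) * sqrt (s / \<theta>)
        + L * sqrt 2 ^ n * exp (- \<omega>\<^sup>2 / 8))"
    proof (rule gauss_area_tube_le[OF assms _ _ _ J(1) _ g s(1) s_\<theta>])
      show "radon_measure (\<mu> (t\<^sub>0 - s))"
        using flow I by (simp add: mean_curvature_flow_def brakke_flow_def)
      show "entropy n (\<mu> (t\<^sub>0 - s)) \<le> ennreal L"
        using ent I by (auto simp: flow_entropy_le_def L_def intro: order_trans ennreal_leI)
      fix y assume y: "y \<in> support (\<mu> (t\<^sub>0 - s))"
      show "norm (off_axis J (g y - q)) \<le> R * sqrt s \<or> \<omega>\<^sup>2 * \<theta> \<le> (norm (y - x))\<^sup>2"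
      proof (cases "y \<in> ball x\<^sub>0 (sqrt s / \<eta>)")
        case True
        with y tube show ?thesis by blast
      next
        case False
        \<comment> \<open>\<open>x\<close> is in the ball of half the radius and \<open>y\<close>
          outside the full ball, so they are at least half a radius apart.\<close>
        have "dist x\<^sub>0 x < sqrt s / (2 * \<eta>)" "2 * (sqrt s / (2 * \<eta>)) \<le> dist x\<^sub>0 y"
          using False x(1) by (simp_all add: mult.commute)
        then have "sqrt s / (2 * \<eta>) \<le> norm (y - x)"
          using dist_triangle[of x\<^sub>0 y x] unfolding dist_norm[of y, symmetric] dist_commute[of y]
          by linarith
        then have "(sqrt s / (2 * \<eta>))\<^sup>2 \<le> (norm (y - x))\<^sup>2"
          using s \<eta> by (intro power_mono) auto
        with \<theta>_lt show ?thesis by linarith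
      qed
    qed (use J j in \<open>auto simp: L_def\<close>)
    finally have "1 \<le> L * exp (R\<^sup>2 / 8) * sqrt 2 ^ (n + 1) * sqrt (s / \<theta>)
        + L * sqrt 2 ^ n * exp (- \<omega>\<^sup>2 / 8)"
      by (simp only: ennreal_ge_1)
    moreover have "s / \<theta> \<le> 1 / T"
      using \<theta>_gt s s_\<theta> T by (simp add: field_simps)
    ultimately show False
      using small(1)[of "s / \<theta>"] small(2) s s_\<theta> by simp
  qed
  with T \<omega> show ?thesis
    by (intro exI[of _ T] exI[of _ \<omega>] conjI allI impI ballI equals0I) (auto simp del: mem_ball)
qed

end
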